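(* Let $G=\mathrm{GL}(m|n)$ and $1\le i,j,k,l\le m+n$. The values $(y_{ij})\,{}_{kl}D$ of the right superderivations ${}_{kl}D$ on the elements $y_{ij}\in K[G]$ are given by the following table, where the row is determined by the block containing $(i,j)$ and the column by the block containing $(k,l)$: $$\begin{array}{l|cccc} (ij)\backslash(kl)&I_{11}&I_{12}&I_{21}&I_{22}\\ \hline I_{11}&\delta_{jk}y_{il}&\delta_{jk}\sum_{u=1}^my_{iu}y_{ul}&0&0\\ I_{12}&-(1-\delta_{ki})\delta_{il}y_{kj}&y_{il}y_{kj}&\delta_{jk}\delta_{il}&\delta_{jk}y_{il}\\ I_{21}&0&\dfrac{y_{il}A_{kj}}{D}&0&0\\ I_{22}&0&y_{il}y_{kj}&0&\delta_{jk}y_{il} \end{array}$$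
   Context: $K$ is an algebraically closed field. $K[G]=K[x_{ij}\mid1\le i,j\le m+n]_{D_1D_2}$ is the coordinate superalgebra of $\mathrm{GL}(m|n)$, where $x_{ij}$ is even if $i,j\le m$ or $i,j>m$ and odd otherwise (supercommutative, odd elements square to zero). The generic matrix is $X=(x_{ij})=\begin{pmatrix}X_{11}&X_{12}\\ X_{21}&X_{22}\end{pmatrix}$ with $X_{11}$ of size $m\times m$ and $X_{22}$ of size $n\times n$, and $D_1=\det X_{11}$, $D_2=\det X_{22}$. The index blocks are: $(i,j)\in I_{11}$ iff $i,j\le m$; $(i,j)\in I_{12}$ iff $i\le m<j$; $(i,j)\in I_{21}$ iff $j\le m<i$; $(i,j)\in I_{22}$ iff $i,j>m$. Put $D=\det X_{11}$ and let $A_{uv}$ be the $(u,v)$ entry of the adjugate of $X_{11}$, so that $X_{11}^{-1}=(A_{uv}/D)_{u,v}$. The element $y_{ij}\in K[G]$ is - $y_{ij}=x_{ij}$ for $(i,j)\in I_{11}$; - the corresponding entry of $X_{11}^{-1}X_{12}$ for $(i,j)\in I_{12}$, i.e. $y_{ij}=\frac1D\sum_{u=1}^mA_{iu}x_{uj}$; - the corresponding entry of $X_{21}X_{11}^{-1}$ for $(i,j)\in I_{21}$, i.e. $y_{ij}=\frac1D\sum_{u=1}^mx_{iu}A_{uj}$; - the corresponding entry of $X_{22}-X_{21}X_{11}^{-1}X_{12}$ for $(i,j)\in I_{22}$. (Thus $y_{ij}$ is the image of $x_{ij}$ under the isomorphism $\phi^*:K[U^-]\otimes K[G_{ev}]\otimes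 K[U^+]\to K[G]$ given by $X_{21}\mapsto X_{21}X_{11}^{-1}$, $X_{11}\mapsto X_{11}$, $X_{22}\mapsto X_{22}-X_{21}X_{11}^{-1}X_{12}$, $X_{12}\mapsto X_{11}^{-1}X_{12}$, where $G_{ev}\simeq\mathrm{GL}(m)\times\mathrm{GL}(n)$ is the even subsupergroup and $U^-$, $U^+$ are the lower and upper block-unitriangular odd unipotent subsupergroups.) The right superderivation ${}_{kl}D$ of $K[G]$ has parity equal to the parity $|x_{kl}|$ of $x_{kl}$, is written to the right of its argument, is determined by $(x_{uv})\,{}_{kl}D=\delta_{vk}x_{ul}$, and satisfies $(ab)\,{}_{kl}D=(-1)^{|b||x_{kl}|}((a)\,{}_{kl}D)\,b+a\,((b)\,{}_{kl}D)$ for homogeneous $a,b$.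
   Formalization: The entry in row I_12, column I_11 is corrected from -(1-δ_{ki})δ_{il}y_{kj} to -δ_{il}y_{kj}; the printed one fails for k=i=l, e.g. in GL(1|1), where (y_12) _{11}D = -y_12, not 0. *)

theory Defs
  imports
    "HOL-Library.Poly_Mapping"
    "HOL-Library.Product_Lexorder"
    "HOL-Computational_Algebra.Fraction_Field"
    "Jordan_Normal_Form.Determinant"
begin

section \<open>Exterior algebras\<close>

text \<open>
  The exterior algebra over the commutative ring \<open>'r\<close> on the linearly ordered set
  \<open>'g\<close> of generators.  An element is the function sending a finite set
  \<open>S = {s\<^sub>1 < \<dots> < s\<^sub>p}\<close> to the coefficient of the monomial \<open>s\<^sub>1 \<and> \<dots> \<and> s\<^sub>p\<close>.
\<close>

typedef (overloaded) ('g, 'r) grassmann =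
  "{f :: 'g set \<Rightarrow> 'r::zero. finite {S. f S \<noteq> 0} \<and> (\<forall>S. f S \<noteq> 0 \<longrightarrow> finite S)}"
  morphisms gcoeff Grassmann
  by (rule exI[of _ "\<lambda>_. 0"]) simp

text \<open>The sign arising when the product of the monomials of the disjoint sets \<open>T\<close> and \<open>U\<close> is sorted.\<close>

definition merge_sign :: "'g::linorder set \<Rightarrow> 'g set \<Rightarrow> 'r::ring_1" where
  "merge_sign T U = (-1) ^ card {(t, u). t \<in> T \<and> u \<in> U \<and> u < t}"

lemma gcoeff_finite_support: "finite {S. gcoeff a S \<noteq> 0}"
  and gcoeff_infinite: "infinite S \<Longrightarrow> gcoeff a S = 0"
  using gcoeff[of a] by auto

lemma gcoeff_finiteD:
  "gcoeff a S \<noteq> 0 \<Longrightarrow> finite S"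
  "gcoeff a S \<noteq> gcoeff b S \<Longrightarrow> finite S"
  by (metis gcoeff_infinite)+

lemma grassmann_eqI: "(\<And>S. finite S \<Longrightarrow> gcoeff a S = gcoeff b S) \<Longrightarrow> a = b"
  by (metis (no_types, opaque_lifting) ext gcoeff_inject gcoeff_infinite)

lemma gcoeff_Grassmann:
  assumes "finite A" "\<And>S. f S \<noteq> 0 \<Longrightarrow> S \<in> A \<and> finite S"
  shows "gcoeff (Grassmann f) = f"
proof (rule Grassmann_inverse)
  have "{S. f S \<noteq> 0} \<subseteq> A" using assms by auto
  then show "f \<in> {f. finite {S. f S \<noteq> 0} \<and> (\<forall>S. f S \<noteq> 0 \<longrightarrow> finite S)}"
    using assms finite_subset by auto
qed

instantiation grassmann :: (type, zero) zero
begin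
definition "0 = Grassmann (\<lambda>_. 0)"
instance ..
end

instantiation grassmann :: (type, ab_group_add) ab_group_add
begin
definition "a + b = Grassmann (\<lambda>S. gcoeff a S + gcoeff b S)"
definition "- a = Grassmann (\<lambda>S. - gcoeff a S)"
definition "a - b = Grassmann (\<lambda>S. gcoeff a S - gcoeff b S)"

lemma gcoeff_zero [simp]: "gcoeff (0 :: ('a, 'b) grassmann) S = 0"
  unfolding zero_grassmann_def by (subst gcoeff_Grassmann[of "{}"]) auto

lemma gcoeff_add [simp]: "gcoeff (a + b :: ('a, 'b) grassmann) S = gcoeff a S + gcoeff b S"
  unfolding plus_grassmann_def
proof (subst gcoeff_Grassmann[of "{S. gcoeff a S \<noteq> 0} \<union> {S. gcoeff b S \<noteq> 0}"])
  fix S assume "gcoeff a S + gcoeff b S \<noteq> 0"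
  then have "gcoeff a S \<noteq> 0 \<or> gcoeff b S \<noteq> 0" by auto
  then show "S \<in> {S. gcoeff a S \<noteq> 0} \<union> {S. gcoeff b S \<noteq> 0} \<and> finite S"
    by (auto intro: gcoeff_finiteD(1))
qed (simp_all add: gcoeff_finite_support)

lemma gcoeff_uminus [simp]: "gcoeff (- a :: ('a, 'b) grassmann) S = - gcoeff a S"
  unfolding uminus_grassmann_def
  by (subst gcoeff_Grassmann[of "{S. gcoeff a S \<noteq> 0}"])
     (auto simp: gcoeff_finite_support intro: gcoeff_finiteD)

lemma gcoeff_minus [simp]: "gcoeff (a - b :: ('a, 'b) grassmann) S = gcoeff a S - gcoeff b S"
  unfolding minus_grassmann_def
  by (subst gcoeff_Grassmann[of "{S. gcoeff a S \<noteq> 0} \<union> {S. gcoeff b S \<noteq> 0}"])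
     (auto simp: gcoeff_finite_support intro: gcoeff_finiteD)

instance
  by standard (auto intro!: grassmann_eqI simp: algebra_simps)
end

definition gscalar :: "'r::zero \<Rightarrow> ('g, 'r) grassmann" where
  "gscalar c = Grassmann (\<lambda>S. if S = {} then c else 0)"

definition ggen :: "'g \<Rightarrow> ('g, 'r::zero_neq_one) grassmann" where
  "ggen g = Grassmann (\<lambda>S. if S = {g} then 1 else 0)"

lemma gcoeff_gscalar: "gcoeff (gscalar c) S = (if S = {} then c else 0)"
  unfolding gscalar_def by (subst gcoeff_Grassmann[of "{{}}"]) (auto split: if_splits)

lemma gcoeff_ggen: "gcoeff (ggen g) S = (if S = {g} then 1 else 0)"
  unfolding ggen_def by (subst gcoeff_Grassmann[of "{{g}}"]) (auto split: if_splits)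

lemma merge_sign_empty [simp]: "merge_sign {} U = 1" "merge_sign T {} = 1"
  by (simp_all add: merge_sign_def)

lemma merge_sign_union:
  assumes "finite R" "finite Q" "finite V" "R \<inter> Q = {}"
  shows "merge_sign (R \<union> Q) V = (merge_sign R V * merge_sign Q V :: 'r::ring_1)"
    and "merge_sign V (R \<union> Q) = (merge_sign V R * merge_sign V Q :: 'r::ring_1)"
proof -
  let ?I = "\<lambda>T U. {(t, u). t \<in> T \<and> u \<in> U \<and> u < t}"
  have fin: "finite (?I T U)" if "finite T" "finite U" for T U
    by (rule finite_subset[of _ "T \<times> U"]) (use that in auto)
  have "card (?I (R \<union> Q) V) = card (?I R V \<union> ?I Q V)"
    by (rule arg_cong[of _ _ card]) auto
  also have "\<dots> = card (?I R V) + card (?I Q V)"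
    by (rule card_Un_disjoint) (use assms fin in auto)
  finally show "merge_sign (R \<union> Q) V = (merge_sign R V * merge_sign Q V :: 'r)"
    by (simp add: merge_sign_def power_add)
  have "card (?I V (R \<union> Q)) = card (?I V R \<union> ?I V Q)"
    by (rule arg_cong[of _ _ card]) auto
  also have "\<dots> = card (?I V R) + card (?I V Q)"
    by (rule card_Un_disjoint) (use assms fin in auto)
  finally show "merge_sign V (R \<union> Q) = (merge_sign V R * merge_sign V Q :: 'r)"
    by (simp add: merge_sign_def power_add)
qed

instantiation grassmann :: (linorder, comm_ring_1) ring_1
begin
definition "1 = gscalar 1"
definition "a * b = Grassmann (\<lambda>S. \<Sum>T\<in>Pow S. merge_sign T (S - T) * gcoeff a T * gcoeff b (S - T))"

lemma gcoeff_times: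
  "gcoeff (a * b :: ('a, 'b) grassmann) S =
     (\<Sum>T\<in>Pow S. merge_sign T (S - T) * gcoeff a T * gcoeff b (S - T))"
proof -
  let ?A = "(\<lambda>(T, U). T \<union> U) ` ({S. gcoeff a S \<noteq> 0} \<times> {S. gcoeff b S \<noteq> 0})"
  have "S \<in> ?A \<and> finite S"
    if nz: "(\<Sum>T\<in>Pow S. merge_sign T (S - T) * gcoeff a T * gcoeff b (S - T)) \<noteq> 0" for S
  proof -
    from nz have "finite S"
      by (metis finite_Pow_iff sum.infinite)
    moreover obtain T where "T \<in> Pow S" "merge_sign T (S - T) * gcoeff a T * gcoeff b (S - T) \<noteq> 0"
      using nz by (meson sum.neutral)
    then have "T \<subseteq> S" "gcoeff a T \<noteq> 0" "gcoeff b (S - T) \<noteq> 0" by auto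
    then have "S \<in> ?A" by (intro image_eqI[of _ _ "(T, S - T)"]) auto
    ultimately show ?thesis by simp
  qed
  then show ?thesis
    unfolding times_grassmann_def
    by (subst gcoeff_Grassmann[of ?A]) (auto simp: gcoeff_finite_support)
qed

instance
proof
  fix a b c :: "('a, 'b) grassmann"
  show "a * b * c = a * (b * c)"
  proof (rule grassmann_eqI)
    fix S :: "'a set" assume S: "finite S"
    let ?s = "merge_sign :: 'a set \<Rightarrow> 'a set \<Rightarrow> 'b"
    let ?f = "\<lambda>T R. ?s T (S - T) * ?s R (T - R) * gcoeff a R * gcoeff b (T - R) * gcoeff c (S - T)"
    let ?g = "\<lambda>R Q. ?s R (S - R) * ?s Q (S - R - Q) * gcoeff a R * gcoeff b Q * gcoeff c (S - R - Q)"
    have "gcoeff (a * b * c) S = (\<Sum>T\<in>Pow S. \<Sum>R\<in>Pow T. ?f T R)"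
      by (simp add: gcoeff_times sum_distrib_left sum_distrib_right mult_ac)
    also have "\<dots> = (\<Sum>(T, R)\<in>Sigma (Pow S) Pow. ?f T R)"
      by (rule sum.Sigma) (use S finite_subset in auto)
    also have "\<dots> = (\<Sum>(R, Q)\<in>Sigma (Pow S) (\<lambda>R. Pow (S - R)). ?g R Q)"
    proof (rule sum.reindex_bij_witness[where i = "\<lambda>(R, Q). (R \<union> Q, R)" and j = "\<lambda>(T, R). (R, T - R)"];
           clarify?)
      fix T R assume "T \<subseteq> S" "R \<subseteq> T"
      then have eq: "S - R = (T - R) \<union> (S - T)" "T = R \<union> (T - R)" "S - R - (T - R) = S - T"
        and fin: "finite R" "finite (T - R)" "finite (S - T)"
        using S by (auto intro: finite_subset)
      have "?s T (S - T) = ?s R (S - T) * ?s (T - R) (S - T)"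
        using merge_sign_union(1)[OF fin, where ?'r = 'b] eq(2) by auto
      moreover have "?s R (S - R) = ?s R (T - R) * ?s R (S - T)"
        using merge_sign_union(2)[OF fin(2,3,1), where ?'r = 'b] eq(1) by auto
      ultimately show "?g R (T - R) = ?f T R"
        by (simp add: eq(3) mult_ac)
    qed auto
    also have "\<dots> = (\<Sum>R\<in>Pow S. \<Sum>Q\<in>Pow (S - R). ?g R Q)"
      by (rule sum.Sigma[symmetric]) (use S finite_subset in auto)
    also have "\<dots> = gcoeff (a * (b * c)) S"
      by (simp add: gcoeff_times sum_distrib_left sum_distrib_right mult_ac)
    finally show "gcoeff (a * b * c) S = gcoeff (a * (b * c)) S" .
  qed
  show "(a + b) * c = a * c + b * c" "a * (b + c) = a * b + a * c"
    by (auto intro!: grassmann_eqI simp: gcoeff_times algebra_simps sum.distrib)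
  show "1 * a = a"
  proof (rule grassmann_eqI)
    fix S :: "'a set" assume "finite S"
    then have "gcoeff (1 * a) S = (\<Sum>T\<in>{{}}. merge_sign T (S - T) * gcoeff 1 T * gcoeff a (S - T))"
      unfolding gcoeff_times
      by (intro sum.mono_neutral_right) (auto simp: one_grassmann_def gcoeff_gscalar)
    then show "gcoeff (1 * a) S = gcoeff a S" by (simp add: one_grassmann_def gcoeff_gscalar)
  qed
  show "a * 1 = a"
  proof (rule grassmann_eqI)
    fix S :: "'a set" assume "finite S"
    then have "gcoeff (a * 1) S = (\<Sum>T\<in>{S}. merge_sign T (S - T) * gcoeff a T * gcoeff 1 (S - T))"
      unfolding gcoeff_times
      by (intro sum.mono_neutral_right) (auto simp: one_grassmann_def gcoeff_gscalar)
    then show "gcoeff (a * 1) S = gcoeff a S" by (simp add: one_grassmann_def gcoeff_gscalar)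
  qed
  have "gcoeff (0 :: ('a, 'b) grassmann) {} \<noteq> gcoeff 1 {}"
    by (simp add: one_grassmann_def gcoeff_gscalar)
  then show "(0 :: ('a, 'b) grassmann) \<noteq> 1" by metis
qed
end

text \<open>The \<open>\<int>/2\<close>-grading; parities are represented by natural numbers modulo 2.\<close>

definition homogeneous :: "nat \<Rightarrow> ('g, 'r::zero) grassmann \<Rightarrow> bool" where
  "homogeneous p a \<longleftrightarrow> (\<forall>S. gcoeff a S \<noteq> 0 \<longrightarrow> card S mod 2 = p mod 2)"


section \<open>The coordinate superalgebra of the general linear supergroup\<close>

text \<open>Matrix indices start at 0, as for the type \<open>mat\<close>: they range over \<open>{..<m + n}\<close>.\<close>

definition I11 :: "nat \<Rightarrow> nat \<Rightarrow> (nat \<times> nat) set" where "I11 m n = {..<m} \<times> {..<m}"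
definition I12 :: "nat \<Rightarrow> nat \<Rightarrow> (nat \<times> nat) set" where "I12 m n = {..<m} \<times> {m..<m+n}"
definition I21 :: "nat \<Rightarrow> nat \<Rightarrow> (nat \<times> nat) set" where "I21 m n = {m..<m+n} \<times> {..<m}"
definition I22 :: "nat \<Rightarrow> nat \<Rightarrow> (nat \<times> nat) set" where "I22 m n = {m..<m+n} \<times> {m..<m+n}"

definition par :: "nat \<Rightarrow> nat \<Rightarrow> nat \<Rightarrow> nat" where
  "par m i j = (if i < m \<longleftrightarrow> j < m then 0 else 1)"

type_synonym 'k evpoly = "((nat \<times> nat) \<Rightarrow>\<^sub>0 nat) \<Rightarrow>\<^sub>0 'k"

definition evar :: "nat \<Rightarrow> nat \<Rightarrow> 'k::comm_ring_1 evpoly" where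
  "evar i j = Poly_Mapping.single (Poly_Mapping.single (i, j) 1) 1"

text \<open>
  All computations take place in the exterior algebra on the odd variables over the field of
  rational functions in the even variables.  The localization of the free supercommutative
  superalgebra at \<open>D\<^sub>1 D\<^sub>2\<close> embeds into it, because \<open>D\<^sub>1 D\<^sub>2\<close> is a nonzero even polynomial;
  it is the subalgebra \<open>coord_superalgebra\<close> below.  The ambient type has generators for all pairs
  of natural numbers; only those with indices below \<open>m + n\<close> occur in the subalgebra.
\<close>

type_synonym 'k superfun = "(nat \<times> nat, 'k evpoly fract) grassmann"

definition of_evpoly :: "'k::field evpoly \<Rightarrow> 'k superfun" where
  "of_evpoly p = gscalar (to_fract p)"

definition inv_evpoly :: "'k::field evpoly \<Rightarrow> 'k superfun" where
  "inv_evpoly p = gscalar (inverse (to_fract p))"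

definition kconst :: "'k::field \<Rightarrow> 'k superfun" where
  "kconst c = of_evpoly (Poly_Mapping.single 0 c)"

definition xel :: "nat \<Rightarrow> nat \<Rightarrow> nat \<Rightarrow> 'k::field superfun" where
  "xel m i j = (if par m i j = 0 then of_evpoly (evar i j) else ggen (i, j))"

definition X11 :: "nat \<Rightarrow> 'k::field evpoly mat" where
  "X11 m = mat m m (\<lambda>(i, j). evar i j)"

definition X22 :: "nat \<Rightarrow> nat \<Rightarrow> 'k::field evpoly mat" where
  "X22 m n = mat n n (\<lambda>(i, j). evar (m + i) (m + j))"

inductive_set coord_superalgebra :: "nat \<Rightarrow> nat \<Rightarrow> 'k::field superfun set" for m n where
  "kconst c \<in> coord_superalgebra m n"
| "i < m + n \<Longrightarrow> j < m + n \<Longrightarrow> xel m i j \<in> coord_superalgebra m n"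
| "inv_evpoly (det (X11 m)) \<in> coord_superalgebra m n"
| "inv_evpoly (det (X22 m n)) \<in> coord_superalgebra m n"
| "a \<in> coord_superalgebra m n \<Longrightarrow> b \<in> coord_superalgebra m n \<Longrightarrow> a + b \<in> coord_superalgebra m n"
| "a \<in> coord_superalgebra m n \<Longrightarrow> b \<in> coord_superalgebra m n \<Longrightarrow> a * b \<in> coord_superalgebra m n"

definition adjel :: "nat \<Rightarrow> nat \<Rightarrow> nat \<Rightarrow> 'k::field superfun" where
  "adjel m u v = of_evpoly (adj_mat (X11 m) $$ (u, v))"

definition invD :: "nat \<Rightarrow> 'k::field superfun" where
  "invD m = inv_evpoly (det (X11 m))"

definition yel :: "nat \<Rightarrow> nat \<Rightarrow> nat \<Rightarrow> 'k::field superfun" where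
  "yel m i j =
    (if i < m \<and> j < m then xel m i j
     else if i < m then invD m * (\<Sum>u<m. adjel m i u * xel m u j)
     else if j < m then invD m * (\<Sum>u<m. xel m i u * adjel m u j)
     else xel m i j - (\<Sum>u<m. \<Sum>v<m. xel m i u * (invD m * adjel m u v) * xel m v j))"

text \<open>
  \<open>right_superderivation m n k l d\<close> says that \<open>d\<close> is the right superderivation
  \<open>\<^bsub>kl\<^esub>D\<close>; its values outside \<open>coord_superalgebra m n\<close> are irrelevant.
\<close>

definition right_superderivation ::
    "nat \<Rightarrow> nat \<Rightarrow> nat \<Rightarrow> nat \<Rightarrow> ('k::field superfun \<Rightarrow> 'k superfun) \<Rightarrow> bool" where
  "right_superderivation m n k l d \<longleftrightarrow>
     (\<forall>a\<in>coord_superalgebra m n. d a \<in> coord_superalgebra m n) \<and>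
     (\<forall>a\<in>coord_superalgebra m n. \<forall>b\<in>coord_superalgebra m n. d (a + b) = d a + d b) \<and>
     (\<forall>c. \<forall>a\<in>coord_superalgebra m n. d (kconst c * a) = kconst c * d a) \<and>
     (\<forall>a\<in>coord_superalgebra m n. \<forall>p. homogeneous p a \<longrightarrow> homogeneous (p + par m k l) (d a)) \<and>
     (\<forall>a\<in>coord_superalgebra m n. \<forall>b\<in>coord_superalgebra m n. \<forall>p q.
        homogeneous p a \<longrightarrow> homogeneous q b \<longrightarrow>
          d (a * b) = (-1) ^ (q * par m k l) * (d a * b) + a * d b) \<and>
     (\<forall>u<m+n. \<forall>v<m+n. d (xel m u v) = of_bool (v = k) * xel m u l)"

text \<open>
  If \<open>d\<close> is the right superderivation with indices \<open>k, l < m\<close>, then \<open>d\<close> maps \<open>X\<^sub>1\<^sub>1\<close> to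
  \<open>X\<^sub>1\<^sub>1 E\<^sub>l\<^sub>k\<close>, where \<open>E\<^sub>l\<^sub>k\<close> is the matrix unit, and kills \<open>X\<^sub>1\<^sub>2\<close>.  Hence it maps
  \<open>X\<^sub>1\<^sub>1\<^sup>-\<^sup>1 X\<^sub>1\<^sub>2\<close> to \<open>- E\<^sub>l\<^sub>k X\<^sub>1\<^sub>1\<^sup>-\<^sup>1 X\<^sub>1\<^sub>2\<close>, so that \<open>d (yel m i j) = - \<delta>\<^sub>i\<^sub>l yel m k j\<close>
  for \<open>i < m \<le> j\<close>, with no exception for \<open>k = i\<close>.  The factor \<open>1 - \<delta>\<^sub>k\<^sub>i\<close> printed in the source in
  this entry of the table would give 0 instead of \<open>- yel m i j\<close> for \<open>k = i = l\<close>, so it is omitted.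
\<close>

end

theory Submission
  imports Defs
begin

text \<open>
  Write \<open>W = X\<^sub>1\<^sub>1\<^sup>-\<^sup>1\<close>.  The superderivation \<open>\<^bsub>kl\<^esub>D\<close> acts on all blocks of \<open>X\<close> by
  one rule, \<open>X \<mapsto> X E\<^sub>l\<^sub>k\<close> with \<open>E\<^sub>l\<^sub>k\<close> the matrix unit: column \<open>k\<close> becomes column
  \<open>l\<close> of \<open>X\<close>, and all other columns become zero.  The sixteen entries of the table are therefore instances of only four formulas, one for each block
  of \<open>(i, j)\<close>, once two matrices with all \<open>m + n\<close> columns replace the blocks of \<open>y\<close>:

  \<^item> \<open>Z = W (X\<^sub>1\<^sub>1 | X\<^sub>1\<^sub>2) = (1 | W X\<^sub>1\<^sub>2)\<close>, the constant \<open>left_quot\<close>, whose columns are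
    unit vectors on the left and columns of \<open>y\<close> on the right;
  \<^item> \<open>C = (X\<^sub>2\<^sub>1 | X\<^sub>2\<^sub>2) - X\<^sub>2\<^sub>1 Z = (0 | X\<^sub>2\<^sub>2 - X\<^sub>2\<^sub>1 W X\<^sub>1\<^sub>2)\<close>, the constant \<open>elim_row\<close>,
    zero on the left and the Schur complement on the right.

  Applying the product rule to \<open>W X\<^sub>1\<^sub>1 = 1\<close>, in which all entries are even, gives
  \<open>(W\<^sub>i\<^sub>j) \<^bsub>kl\<^esub>D = - [k < m] Z\<^sub>i\<^sub>l W\<^sub>k\<^sub>j\<close> (\<open>deriv_inv_entry\<close>).  From this, with
  \<open>p\<close> the parity of \<open>\<^bsub>kl\<^esub>D\<close>, the product rule yields

  \<^item> \<open>(y\<^sub>i\<^sub>j) \<^bsub>kl\<^esub>D = \<delta>\<^sub>j\<^sub>k Z\<^sub>i\<^sub>l - (-1)\<^sup>p [k < m] Z\<^sub>i\<^sub>l y\<^sub>k\<^sub>j\<close> for the entries of \<open>W X\<^sub>1\<^sub>2\<close>;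
  \<^item> \<open>(y\<^sub>i\<^sub>j) \<^bsub>kl\<^esub>D = [k < m] C\<^sub>i\<^sub>l W\<^sub>k\<^sub>j\<close> for the entries of \<open>X\<^sub>2\<^sub>1 W\<close>;
  \<^item> \<open>(y\<^sub>i\<^sub>j) \<^bsub>kl\<^esub>D = \<delta>\<^sub>j\<^sub>k C\<^sub>i\<^sub>l - (-1)\<^sup>p [k < m] C\<^sub>i\<^sub>l y\<^sub>k\<^sub>j\<close> for those of the Schur complement,

  while \<open>X\<^sub>1\<^sub>1 Z = (X\<^sub>1\<^sub>1 | X\<^sub>1\<^sub>2)\<close> settles the block \<open>X\<^sub>1\<^sub>1\<close>.  Reading off \<open>Z\<close>, \<open>C\<close> and \<open>p\<close> in
  each block of \<open>(k, l)\<close> gives the table.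

  The product rule is available only for homogeneous elements of the coordinate superalgebra.  So the
  entries of \<open>W\<close> have to be shown to lie in it, which holds because cofactors are polynomials in the
  even variables; and \<open>W X\<^sub>1\<^sub>1 = 1\<close> needs \<open>det X\<^sub>1\<^sub>1 \<noteq> 0\<close>, since the formal inverse of 0 is 0.
\<close>

section \<open>Scalars in an exterior algebra\<close>

lemma gcoeff_sum: "gcoeff (\<Sum>i\<in>I. f i) S = (\<Sum>i\<in>I. gcoeff (f i) S)"
  by (induction I rule: infinite_finite_induct) simp_all

lemma gcoeff_gscalar_mult:
  fixes c :: "'r::comm_ring_1" and a :: "('g::linorder, 'r) grassmann"
  assumes "finite S"
  shows "gcoeff (gscalar c * a) S = c * gcoeff a S"
proof -
  have "gcoeff (gscalar c * a) S =
      (\<Sum>T\<in>{{}}. merge_sign T (S - T) * gcoeff (gscalar c) T * gcoeff a (S - T))"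
    unfolding gcoeff_times
    by (intro sum.mono_neutral_right) (auto simp: gcoeff_gscalar assms)
  then show ?thesis by (simp add: gcoeff_gscalar)
qed

lemma gcoeff_mult_gscalar:
  fixes c :: "'r::comm_ring_1" and a :: "('g::linorder, 'r) grassmann"
  assumes "finite S"
  shows "gcoeff (a * gscalar c) S = c * gcoeff a S"
proof -
  have "gcoeff (a * gscalar c) S =
      (\<Sum>T\<in>{S}. merge_sign T (S - T) * gcoeff a T * gcoeff (gscalar c) (S - T))"
    unfolding gcoeff_times
    by (intro sum.mono_neutral_right) (auto simp: gcoeff_gscalar assms)
  then show ?thesis by (simp add: gcoeff_gscalar)
qed

lemma gscalar_central:
  fixes c :: "'r::comm_ring_1" and a :: "('g::linorder, 'r) grassmann"
  shows "a * gscalar c = gscalar c * a"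
  by (rule grassmann_eqI) (simp add: gcoeff_gscalar_mult gcoeff_mult_gscalar)

lemma gscalar_mult:
  "gscalar (b * c) = (gscalar b * gscalar c :: ('g::linorder, 'r::comm_ring_1) grassmann)"
  by (rule grassmann_eqI) (simp add: gcoeff_gscalar_mult gcoeff_gscalar)

lemma gscalar_add: "gscalar (b + c) = gscalar b + gscalar c"
  by (rule grassmann_eqI) (simp add: gcoeff_gscalar)

lemma gscalar_0: "gscalar 0 = (0 :: ('g, 'r::ab_group_add) grassmann)"
  by (rule grassmann_eqI) (simp add: gcoeff_gscalar)

lemma gscalar_1: "gscalar 1 = (1 :: ('g::linorder, 'r::comm_ring_1) grassmann)"
  by (simp add: one_grassmann_def)

lemma homogeneous_gscalar: "homogeneous 0 (gscalar c)"
  by (simp add: homogeneous_def gcoeff_gscalar)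

lemma homogeneous_ggen: "homogeneous 1 (ggen g)"
  by (simp add: homogeneous_def gcoeff_ggen)

lemma homogeneous_gscalar_mult:
  fixes c :: "'r::comm_ring_1" and a :: "('g::linorder, 'r) grassmann"
  assumes "homogeneous p a"
  shows "homogeneous p (gscalar c * a)"
  unfolding homogeneous_def
proof (intro allI impI)
  fix S assume nz: "gcoeff (gscalar c * a) S \<noteq> 0"
  then have "gcoeff a S \<noteq> 0"
    using gcoeff_gscalar_mult[OF gcoeff_finiteD(1)[OF nz], of c a] by auto
  then show "card S mod 2 = p mod 2" using assms by (simp add: homogeneous_def)
qed

lemma homogeneous_sum:
  fixes f :: "'i \<Rightarrow> ('g, 'r::ab_group_add) grassmann"
  assumes "\<And>i. i \<in> I \<Longrightarrow> homogeneous p (f i)"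
  shows "homogeneous p (\<Sum>i\<in>I. f i)"
  unfolding homogeneous_def
proof (intro allI impI)
  fix S assume "gcoeff (\<Sum>i\<in>I. f i) S \<noteq> 0"
  then obtain i where "i \<in> I" "gcoeff (f i) S \<noteq> 0"
    unfolding gcoeff_sum by (meson sum.neutral)
  then show "card S mod 2 = p mod 2" using assms by (auto simp: homogeneous_def)
qed

section \<open>Even polynomials\<close>

lemma of_evpoly_mult: "of_evpoly (p * q) = of_evpoly p * of_evpoly q"
  by (simp add: of_evpoly_def gscalar_mult)

lemma of_evpoly_add: "of_evpoly (p + q) = of_evpoly p + of_evpoly q"
  by (simp add: of_evpoly_def gscalar_add)

lemma of_evpoly_0: "of_evpoly 0 = 0"
  by (simp add: of_evpoly_def gscalar_0)

lemma of_evpoly_1: "of_evpoly 1 = 1"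
  by (simp add: of_evpoly_def gscalar_1)

lemma of_evpoly_sum: "of_evpoly (\<Sum>i\<in>I. f i) = (\<Sum>i\<in>I. of_evpoly (f i))"
  by (induction I rule: infinite_finite_induct) (simp_all add: of_evpoly_0 of_evpoly_add)

lemma prod_evar:
  "finite I \<Longrightarrow> (\<Prod>i\<in>I. evar (f i) (g i)) =
     (Poly_Mapping.single (\<Sum>i\<in>I. Poly_Mapping.single (f i, g i) 1) 1 :: 'k::comm_ring_1 evpoly)"
  by (induction I rule: finite_induct) (simp_all add: evar_def mult_single)

lemma lookup_sum_poly_mapping:
  "Poly_Mapping.lookup (\<Sum>i\<in>I. f i) x = (\<Sum>i\<in>I. Poly_Mapping.lookup (f i) x)"
  by (induction I rule: infinite_finite_induct) (simp_all add: lookup_add)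

text \<open>
  The terms of the Leibniz formula are distinct monomials up to sign, so none of them cancel: the
  monomial \<open>\<Prod>\<^sub>i x\<^sub>i\<^sub>,\<^sub>p\<^sub>(\<^sub>i\<^sub>)\<close> determines the permutation \<open>p\<close>.  In particular
  the diagonal monomial has coefficient 1.
\<close>

lemma det_generic_matrix_nonzero: "det (X11 m :: 'k::field evpoly mat) \<noteq> 0"
proof
  let ?P = "{p. p permutes {0..<m}}"
  let ?e = "\<lambda>p. \<Sum>i\<in>{0..<m}. Poly_Mapping.single (i, p i) (1::nat)"
  have inj: "p = id" if p: "p permutes {0..<m}" and eq: "?e p = ?e id" for p
  proof
    fix i show "p i = id i"
    proof (cases "i < m")
      case True
      have "Poly_Mapping.lookup (?e p) (i, i) = Poly_Mapping.lookup (?e id) (i, i)"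
        by (simp only: eq)
      then have "(\<Sum>u\<in>{0..<m}. if u = i \<and> p u = i then Suc 0 else 0) = Suc 0"
        using True by (simp add: lookup_sum_poly_mapping lookup_single when_def)
      moreover have "(\<Sum>u\<in>{0..<m}. if u = i \<and> p u = i then Suc 0 else 0) = 0" if "p i \<noteq> i"
        by (rule sum.neutral) (use that in auto)
      ultimately show ?thesis by fastforce
    next
      case False
      then show ?thesis using p by (simp add: permutes_def)
    qed
  qed
  have "det (X11 m) = (\<Sum>p\<in>?P. signof p * (Poly_Mapping.single (?e p) 1 :: 'k evpoly))"
  proof -
    have "(\<Prod>i = 0..<m. X11 m $$ (i, p i)) = (Poly_Mapping.single (?e p) 1 :: 'k evpoly)"
      if "p permutes {0..<m}" for p
    proof -
      have "(\<Prod>i = 0..<m. X11 m $$ (i, p i)) = (\<Prod>i = 0..<m. evar i (p i) :: 'k evpoly)"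
        using permutes_in_image[OF that] by (intro prod.cong) (auto simp: X11_def)
      then show ?thesis by (simp only: prod_evar finite_atLeastLessThan)
    qed
    then show ?thesis by (simp add: det_def X11_def)
  qed
  moreover assume "det (X11 m :: 'k evpoly mat) = 0"
  ultimately have "0 = Poly_Mapping.lookup (\<Sum>p\<in>?P. signof p * (Poly_Mapping.single (?e p) 1 :: 'k evpoly)) (?e id)"
    by simp
  also have "\<dots> = (\<Sum>p\<in>?P. if p = id then 1 else 0)"
    unfolding lookup_sum_poly_mapping
    by (rule sum.cong) (auto simp: sign_def lookup_single when_def dest: inj)
  also have "\<dots> = 1" by (simp add: permutes_id finite_permutations)
  finally show False by simp
qed


section \<open>The subalgebra of coordinate functions\<close>

lemma of_evpoly_uminus: "of_evpoly (- p) = - of_evpoly p"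
proof -
  have "of_evpoly (- p) + of_evpoly p = 0"
    by (simp add: of_evpoly_add[symmetric] of_evpoly_0)
  then show ?thesis by (rule eq_neg_iff_add_eq_0[THEN iffD2])
qed

lemma kconst_0: "kconst 0 = 0"
  by (simp add: kconst_def of_evpoly_0)

lemma kconst_1: "kconst 1 = 1"
  by (simp add: kconst_def of_evpoly_1)

lemma kconst_minus_1: "kconst (- 1) = - 1"
  by (simp add: kconst_def single_uminus of_evpoly_uminus of_evpoly_1)

lemma coord_0: "0 \<in> coord_superalgebra m n"
  using coord_superalgebra.intros(1)[of 0] by (simp add: kconst_0)

lemma coord_1: "1 \<in> coord_superalgebra m n"
  using coord_superalgebra.intros(1)[of 1] by (simp add: kconst_1)

lemma coord_uminus: "a \<in> coord_superalgebra m n \<Longrightarrow> - a \<in> coord_superalgebra m n"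
  using coord_superalgebra.intros(6)[OF coord_superalgebra.intros(1)[of "- 1"]]
  by (simp add: kconst_minus_1)

lemma coord_diff:
  "a \<in> coord_superalgebra m n \<Longrightarrow> b \<in> coord_superalgebra m n \<Longrightarrow> a - b \<in> coord_superalgebra m n"
  using coord_superalgebra.intros(5)[OF _ coord_uminus] by fastforce

lemma coord_sum:
  "(\<And>i. i \<in> I \<Longrightarrow> f i \<in> coord_superalgebra m n) \<Longrightarrow> (\<Sum>i\<in>I. f i) \<in> coord_superalgebra m n"
  by (induction I rule: infinite_finite_induct)
     (auto intro: coord_0 coord_superalgebra.intros(5))

lemma of_evpoly_prod_mem:
  "(\<And>i. i \<in> I \<Longrightarrow> of_evpoly (f i) \<in> coord_superalgebra m n) \<Longrightarrow>
     of_evpoly (\<Prod>i\<in>I. f i) \<in> coord_superalgebra m n"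
  by (induction I rule: infinite_finite_induct)
     (auto simp: of_evpoly_1 of_evpoly_mult intro: coord_1 coord_superalgebra.intros(6))

text \<open>
  This serves for minors of the generic matrix, so that adjugate entries become coordinate
  functions.  The determinant of a non-square matrix is 0 by convention.
\<close>

lemma of_evpoly_det_mem:
  assumes "\<And>u v. u < dim_row A \<Longrightarrow> v < dim_col A \<Longrightarrow> of_evpoly (A $$ (u, v)) \<in> coord_superalgebra m n"
  shows "of_evpoly (det A) \<in> coord_superalgebra m n"
proof -
  have "of_evpoly (signof p * (\<Prod>i = 0..<dim_row A. A $$ (i, p i))) \<in> coord_superalgebra m n"
    if p: "p permutes {0..<dim_row A}" and dim: "dim_row A = dim_col A" for p
  proof -
    have "of_evpoly (\<Prod>i = 0..<dim_row A. A $$ (i, p i)) \<in> coord_superalgebra m n"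
      using permutes_in_image[OF p] dim by (intro of_evpoly_prod_mem assms) auto
    then show ?thesis
      by (auto simp: sign_def of_evpoly_uminus intro: coord_uminus)
  qed
  then show ?thesis
    by (auto simp: det_def of_evpoly_sum of_evpoly_0 intro: coord_sum coord_0)
qed

lemma adjel_mem:
  assumes "u < m" "v < m"
  shows "(adjel m u v :: 'k::field superfun) \<in> coord_superalgebra m n"
proof -
  have minor: "of_evpoly (det (mat_delete (X11 m) v u) :: 'k evpoly) \<in> coord_superalgebra m n"
  proof (rule of_evpoly_det_mem)
    fix r c assume rc: "r < dim_row (mat_delete (X11 m :: 'k evpoly mat) v u)"
      "c < dim_col (mat_delete (X11 m :: 'k evpoly mat) v u)"
    define r' c' where "r' = (if r < v then r else Suc r)" and "c' = (if c < u then c else Suc c)"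
    have "mat_delete (X11 m) v u $$ (r, c) = (evar r' c' :: 'k evpoly)" "r' < m" "c' < m"
      using rc by (auto simp: mat_delete_def X11_def r'_def c'_def)
    then show "of_evpoly (mat_delete (X11 m) v u $$ (r, c) :: 'k evpoly) \<in> coord_superalgebra m n"
      using coord_superalgebra.intros(2)[of r' m n c'] by (simp add: xel_def par_def)
  qed
  have "of_evpoly ((- 1) ^ (v + u) * det (mat_delete (X11 m) v u) :: 'k evpoly) \<in> coord_superalgebra m n"
    using minor by (cases "even (v + u)") (simp_all add: of_evpoly_uminus coord_uminus)
  then show ?thesis
    using assms by (simp add: adjel_def adj_mat_def cofactor_def X11_def)
qed

section \<open>The inverse of the even block\<close>

text \<open>The matrix \<open>X\<^sub>1\<^sub>1\<^sup>-\<^sup>1\<close>, by Cramer's rule.\<close>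

definition inv_entry :: "nat \<Rightarrow> nat \<Rightarrow> nat \<Rightarrow> 'k::field superfun" where
  "inv_entry m u v = invD m * adjel m u v"

lemma inv_entry_eq_gscalar:
  "inv_entry m u v = gscalar (inverse (to_fract (det (X11 m))) * to_fract (adj_mat (X11 m) $$ (u, v)))"
  by (simp add: inv_entry_def invD_def adjel_def inv_evpoly_def of_evpoly_def gscalar_mult)

lemma inv_entry_central: "a * inv_entry m u v = inv_entry m u v * a"
  unfolding inv_entry_eq_gscalar by (rule gscalar_central)

lemma inv_entry_mem:
  "u < m \<Longrightarrow> v < m \<Longrightarrow> inv_entry m u v \<in> coord_superalgebra m n"
  unfolding inv_entry_def invD_def
  by (intro coord_superalgebra.intros(6,3) adjel_mem)

lemma inv_det_mult: "invD m * of_evpoly (det (X11 m)) = 1"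
  by (simp add: invD_def inv_evpoly_def of_evpoly_def gscalar_mult[symmetric]
      det_generic_matrix_nonzero gscalar_1)

lemma inv_mult_X11:
  assumes "i < m" "j < m"
  shows "(\<Sum>u<m. inv_entry m i u * xel m u j) = of_bool (i = j)"
proof -
  let ?A = "X11 m :: 'a evpoly mat"
  have A: "?A \<in> carrier_mat m m" by (simp add: X11_def)
  have "(\<Sum>u<m. adj_mat ?A $$ (i, u) * evar u j) = (adj_mat ?A * ?A) $$ (i, j)"
    using assms adj_mat(1)[OF A] A
    by (auto simp: scalar_prod_def X11_def lessThan_atLeast0 intro!: sum.cong)
  also have "\<dots> = (if i = j then det ?A else 0)"
    using assms by (simp add: adj_mat(3)[OF A])
  finally have adj: "(\<Sum>u<m. adj_mat ?A $$ (i, u) * evar u j) = (if i = j then det ?A else 0)" .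
  have "(\<Sum>u<m. inv_entry m i u * xel m u j)
      = invD m * of_evpoly (\<Sum>u<m. adj_mat ?A $$ (i, u) * evar u j)"
    using assms
    by (simp add: inv_entry_def adjel_def xel_def par_def of_evpoly_sum of_evpoly_mult
        sum_distrib_left mult.assoc)
  then show ?thesis by (simp add: adj inv_det_mult of_evpoly_0)
qed

lemma X11_mult_inv:
  assumes "i < m" "j < m"
  shows "(\<Sum>u<m. xel m i u * inv_entry m u j) = of_bool (i = j)"
proof -
  let ?A = "X11 m :: 'a evpoly mat"
  have A: "?A \<in> carrier_mat m m" by (simp add: X11_def)
  have "(\<Sum>u<m. evar i u * adj_mat ?A $$ (u, j)) = (?A * adj_mat ?A) $$ (i, j)"
    using assms adj_mat(1)[OF A] A
    by (auto simp: scalar_prod_def X11_def lessThan_atLeast0 intro!: sum.cong)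
  also have "\<dots> = (if i = j then det ?A else 0)"
    using assms by (simp add: adj_mat(2)[OF A])
  finally have adj: "(\<Sum>u<m. adj_mat ?A $$ (u, j) * evar i u) = (if i = j then det ?A else 0)"
    by (simp add: mult.commute)
  have "(\<Sum>u<m. xel m i u * inv_entry m u j) = (\<Sum>u<m. inv_entry m u j * xel m i u)"
    by (simp only: inv_entry_central)
  also have "\<dots> = invD m * of_evpoly (\<Sum>u<m. adj_mat ?A $$ (u, j) * evar i u)"
    using assms
    by (simp add: inv_entry_def adjel_def xel_def par_def of_evpoly_sum
        of_evpoly_mult sum_distrib_left mult.assoc)
  finally have "(\<Sum>u<m. xel m i u * inv_entry m u j)
      = invD m * of_evpoly (\<Sum>u<m. adj_mat ?A $$ (u, j) * evar i u)" .
  then show ?thesis by (simp add: adj inv_det_mult of_evpoly_0)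
qed

text \<open>
  The product of \<open>X\<^sub>1\<^sub>1\<^sup>-\<^sup>1\<close> with the upper rows of \<open>X\<close>.  Allowing the columns \<open>l < m\<close>, where it is
  the identity matrix, makes one formula for \<open>\<^bsub>kl\<^esub>D\<close> cover even and odd \<open>\<^bsub>kl\<^esub>D\<close>.
\<close>

definition left_quot :: "nat \<Rightarrow> nat \<Rightarrow> nat \<Rightarrow> 'k::field superfun" where
  "left_quot m i l = (\<Sum>u<m. inv_entry m i u * xel m u l)"

text \<open>
  The lower rows of \<open>X\<close> after block elimination with \<open>X\<^sub>1\<^sub>1\<close> as pivot: zero in the first \<open>m\<close>
  columns, the Schur complement of \<open>X\<^sub>1\<^sub>1\<close> in the others.
\<close>

definition elim_row :: "nat \<Rightarrow> nat \<Rightarrow> nat \<Rightarrow> 'k::field superfun" where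
  "elim_row m i l = xel m i l - (\<Sum>u<m. xel m i u * left_quot m u l)"

lemma left_quot_even: "i < m \<Longrightarrow> l < m \<Longrightarrow> left_quot m i l = of_bool (i = l)"
  by (simp add: left_quot_def inv_mult_X11)

lemma left_quot_odd: "i < m \<Longrightarrow> m \<le> l \<Longrightarrow> left_quot m i l = yel m i l"
  by (simp add: left_quot_def yel_def inv_entry_def sum_distrib_left mult.assoc)

lemma elim_row_even: "l < m \<Longrightarrow> elim_row m i l = 0"
  by (simp add: elim_row_def left_quot_even of_bool_def if_distrib cong: if_cong)

lemma elim_row_odd: "m \<le> i \<Longrightarrow> m \<le> l \<Longrightarrow> elim_row m i l = yel m i l"
  by (simp add: elim_row_def left_quot_def yel_def inv_entry_def sum_distrib_left mult.assoc)

lemma X11_mult_left_quot: "i < m \<Longrightarrow> (\<Sum>u<m. xel m i u * left_quot m u l) = xel m i l"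
proof -
  assume i: "i < m"
  have "(\<Sum>u<m. xel m i u * left_quot m u l)
      = (\<Sum>v<m. (\<Sum>u<m. xel m i u * inv_entry m u v) * xel m v l)"
    unfolding left_quot_def sum_distrib_left sum_distrib_right mult.assoc
    by (rule sum.swap)
  also have "\<dots> = xel m i l"
    using i by (simp add: X11_mult_inv of_bool_def if_distrib if_distribR cong: if_cong)
  finally show ?thesis .
qed

lemma yel_11: "i < m \<Longrightarrow> j < m \<Longrightarrow> yel m i j = xel m i j"
  by (simp add: yel_def)

lemma yel_21:
  assumes "m \<le> i" "j < m"
  shows "yel m i j = (\<Sum>u<m. xel m i u * inv_entry m u j :: 'k::field superfun)"
proof -
  have "invD m * (xel m i u * adjel m u j) = (xel m i u * inv_entry m u j :: 'k superfun)" for u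
    by (simp add: inv_entry_def invD_def inv_evpoly_def gscalar_central mult.assoc[symmetric])
  then show ?thesis using assms by (simp add: yel_def sum_distrib_left)
qed

lemma yel_22: "m \<le> i \<Longrightarrow> m \<le> j \<Longrightarrow> yel m i j = xel m i j - (\<Sum>u<m. xel m i u * yel m u j)"
  by (simp add: elim_row_odd[symmetric] elim_row_def left_quot_odd)

lemma homogeneous_inv_entry: "homogeneous 0 (inv_entry m u v)"
  unfolding inv_entry_eq_gscalar by (rule homogeneous_gscalar)

lemma homogeneous_xel: "homogeneous (par m i j) (xel m i j)"
  by (auto simp: xel_def par_def of_evpoly_def homogeneous_gscalar homogeneous_ggen[unfolded One_nat_def])

lemma homogeneous_yel_12:
  assumes "i < m" "m \<le> j"
  shows "homogeneous 1 (yel m i j :: 'k::field superfun)"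
proof -
  have "homogeneous 1 (inv_entry m i u * xel m u j :: 'k superfun)" if "u < m" for u
    using homogeneous_gscalar_mult[OF homogeneous_xel[of m u j]] assms that
    by (simp add: inv_entry_eq_gscalar par_def)
  then have "homogeneous 1 (left_quot m i j :: 'k superfun)"
    unfolding left_quot_def by (intro homogeneous_sum) simp
  then show ?thesis using assms by (simp add: left_quot_odd)
qed

section \<open>The superderivations\<close>

locale right_superderiv =
  fixes m n k l :: nat and d :: "'k::field superfun \<Rightarrow> 'k superfun"
  assumes superderivation: "right_superderivation m n k l d"
begin

abbreviation sgn_kl :: "'k superfun" where "sgn_kl \<equiv> (- 1) ^ par m k l"

lemma deriv_add:
  "a \<in> coord_superalgebra m n \<Longrightarrow> b \<in> coord_superalgebra m n \<Longrightarrow> d (a + b) = d a + d b"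
  using superderivation by (simp add: right_superderivation_def)

lemma deriv_mult_even:
  assumes "a \<in> coord_superalgebra m n" "b \<in> coord_superalgebra m n"
    and "homogeneous p a" "homogeneous 0 b"
  shows "d (a * b) = d a * b + a * d b"
proof -
  have "d (a * b) = (-1) ^ (0 * par m k l) * (d a * b) + a * d b"
    using superderivation assms unfolding right_superderivation_def by blast
  then show ?thesis by simp
qed

lemma deriv_mult_odd:
  assumes "a \<in> coord_superalgebra m n" "b \<in> coord_superalgebra m n"
    and "homogeneous p a" "homogeneous 1 b"
  shows "d (a * b) = sgn_kl * (d a * b) + a * d b"
proof -
  have "d (a * b) = (-1) ^ (1 * par m k l) * (d a * b) + a * d b"
    using superderivation assms unfolding right_superderivation_def by blast
  then show ?thesis by simp
qed

lemma deriv_xel: "u < m + n \<Longrightarrow> v < m + n \<Longrightarrow> d (xel m u v) = of_bool (v = k) * xel m u l"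
  using superderivation by (simp add: right_superderivation_def)

lemma deriv_0: "d 0 = 0"
  using deriv_add[OF coord_0 coord_0] by simp

lemma deriv_1: "d 1 = 0"
proof -
  have "homogeneous 0 (1 :: 'k superfun)"
    by (simp add: gscalar_1[symmetric] homogeneous_gscalar)
  from deriv_mult_even[OF coord_1 coord_1 this this] show ?thesis by simp
qed

lemma deriv_sum:
  "(\<And>i. i \<in> I \<Longrightarrow> f i \<in> coord_superalgebra m n) \<Longrightarrow> d (\<Sum>i\<in>I. f i) = (\<Sum>i\<in>I. d (f i))"
  by (induction I rule: infinite_finite_induct) (auto simp: deriv_0 deriv_add coord_sum)

lemma deriv_diff:
  assumes "a \<in> coord_superalgebra m n" "b \<in> coord_superalgebra m n"
  shows "d (a - b) = d a - d b"
  using deriv_add[OF coord_diff[OF assms] assms(2)] by simp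

lemma xel_mem: "u < m + n \<Longrightarrow> v < m + n \<Longrightarrow> xel m u v \<in> coord_superalgebra m n"
  by (rule coord_superalgebra.intros(2))

lemma yel_12_mem:
  "i < m \<Longrightarrow> m \<le> j \<Longrightarrow> j < m + n \<Longrightarrow> yel m i j \<in> coord_superalgebra m n"
  by (auto simp: left_quot_odd[symmetric] left_quot_def
      intro!: coord_sum coord_superalgebra.intros(6) inv_entry_mem xel_mem)

text \<open>
  The usual formula \<open>(W) D = - W ((X\<^sub>1\<^sub>1) D) W\<close> for an inverse matrix.  Since \<open>X\<^sub>1\<^sub>1\<close> is even, the
  product rule for \<open>W X\<^sub>1\<^sub>1\<close> carries no sign even when \<open>D\<close> is odd.  The image of \<open>X\<^sub>1\<^sub>1\<close> is its
  column \<open>k\<close> replaced by column \<open>l\<close> of \<open>X\<close> and all others by zero, which makes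
  \<open>W ((X\<^sub>1\<^sub>1) D)\<close> column \<open>l\<close> of \<open>left_quot\<close>, provided that \<open>k < m\<close>.
\<close>

lemma deriv_inv_entry:
  assumes i: "i < m" and j: "j < m"
  shows "d (inv_entry m i j) = - (of_bool (k < m) * (left_quot m i l * inv_entry m k j))"
proof -
  let ?W = "inv_entry m :: nat \<Rightarrow> nat \<Rightarrow> 'k superfun" and ?x = "xel m :: nat \<Rightarrow> nat \<Rightarrow> 'k superfun"
  have deriv_W_X11: "(\<Sum>u<m. d (?W i u) * ?x u v) = - (of_bool (v = k) * left_quot m i l)" if v: "v < m" for v
  proof -
    have prod: "d (?W i u * ?x u v) = d (?W i u) * ?x u v + of_bool (v = k) * (?W i u * ?x u l)"
      if u: "u < m" for u
    proof -
      have "d (?W i u * ?x u v) = d (?W i u) * ?x u v + ?W i u * d (?x u v)"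
        using i u v homogeneous_xel[of m u v]
        by (intro deriv_mult_even[OF _ _ homogeneous_inv_entry] inv_entry_mem xel_mem)
           (auto simp: par_def)
      then show ?thesis using u v by (simp add: deriv_xel)
    qed
    have "0 = d (\<Sum>u<m. ?W i u * ?x u v)"
      using i v by (simp add: inv_mult_X11 deriv_0 deriv_1)
    also have "\<dots> = (\<Sum>u<m. d (?W i u * ?x u v))"
      using i v by (intro deriv_sum coord_superalgebra.intros(6) inv_entry_mem xel_mem) auto
    also have "\<dots> = (\<Sum>u<m. d (?W i u) * ?x u v) + of_bool (v = k) * left_quot m i l"
      by (simp add: prod sum.distrib left_quot_def sum_distrib_left)
    finally show ?thesis by (simp add: eq_neg_iff_add_eq_0)
  qed
  (* Cancel X11 by multiplying with its inverse from the right. *)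
  have "d (?W i j) = (\<Sum>u<m. d (?W i u) * of_bool (u = j))"
    using j by (simp add: of_bool_def if_distrib cong: if_cong)
  also have "\<dots> = (\<Sum>u<m. \<Sum>v<m. d (?W i u) * ?x u v * ?W v j)"
    using j by (simp add: X11_mult_inv[symmetric] sum_distrib_left mult.assoc)
  also have "\<dots> = (\<Sum>v<m. (\<Sum>u<m. d (?W i u) * ?x u v) * ?W v j)"
    by (subst sum.swap) (simp add: sum_distrib_right)
  also have "\<dots> = (\<Sum>v<m. if v = k then - (left_quot m i l * ?W k j) else 0)"
    by (rule sum.cong) (auto simp: deriv_W_X11)
  also have "\<dots> = - (of_bool (k < m) * (left_quot m i l * ?W k j))"
    by simp
  finally show ?thesis .
qed

lemma deriv_yel_11:
  assumes "i < m" "j < m"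
  shows "d (yel m i j) = of_bool (j = k) * (\<Sum>u<m. yel m i u * left_quot m u l)"
  using assms by (simp add: yel_11 deriv_xel X11_mult_left_quot)

text \<open>
  In the product \<open>X\<^sub>1\<^sub>1\<^sup>-\<^sup>1 X\<^sub>1\<^sub>2\<close> the right factor is odd, so an odd \<open>\<^bsub>kl\<^esub>D\<close> picks up a sign
  when it passes to the left factor; this turns the minus sign of \<open>deriv_inv_entry\<close> into the
  plus sign of the table for \<open>k < m \<le> l\<close>.
\<close>

lemma deriv_yel_12:
  assumes i: "i < m" and j: "m \<le> j" "j < m + n"
  shows "d (yel m i j) = of_bool (j = k) * left_quot m i l
           - sgn_kl * (of_bool (k < m) * (left_quot m i l * yel m k j))"
proof -
  let ?W = "inv_entry m :: nat \<Rightarrow> nat \<Rightarrow> 'k superfun" and ?x = "xel m :: nat \<Rightarrow> nat \<Rightarrow> 'k superfun"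
  have prod: "d (?W i u * ?x u j) = of_bool (j = k) * (?W i u * ?x u l)
      - sgn_kl * (of_bool (k < m) * (left_quot m i l * (?W k u * ?x u j)))" if u: "u < m" for u
  proof -
    have "d (?W i u * ?x u j) = sgn_kl * (d (?W i u) * ?x u j) + ?W i u * d (?x u j)"
      using i j u homogeneous_xel[of m u j]
      by (intro deriv_mult_odd[OF _ _ homogeneous_inv_entry] inv_entry_mem xel_mem)
         (auto simp: par_def)
    then show ?thesis using i j u by (simp add: deriv_xel deriv_inv_entry mult.assoc)
  qed
  have "d (yel m i j) = (\<Sum>u<m. d (?W i u * ?x u j))"
    unfolding left_quot_odd[OF i j(1), symmetric] left_quot_def
    using i j by (intro deriv_sum coord_superalgebra.intros(6) inv_entry_mem xel_mem) auto
  also have "\<dots> = of_bool (j = k) * left_quot m i l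
      - sgn_kl * (of_bool (k < m) * (left_quot m i l * left_quot m k j))"
    by (simp add: prod sum_subtractf left_quot_def[of m i l] left_quot_def[of m k j]
        sum_distrib_left)
  finally show ?thesis using j by (cases "k < m") (simp_all add: left_quot_odd)
qed

text \<open>
  For \<open>k < m\<close> the product rule for \<open>X\<^sub>2\<^sub>1 X\<^sub>1\<^sub>1\<^sup>-\<^sup>1\<close> yields \<open>x\<^sub>i\<^sub>l W\<^sub>k\<^sub>j\<close> from the left factor and
  \<open>- (X\<^sub>2\<^sub>1 Z)\<^sub>i\<^sub>l W\<^sub>k\<^sub>j\<close> from the right one: together a row after elimination.
\<close>

lemma deriv_yel_21:
  assumes i: "m \<le> i" "i < m + n" and j: "j < m"
  shows "d (yel m i j) = of_bool (k < m) * (elim_row m i l * inv_entry m k j)"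
proof -
  let ?W = "inv_entry m :: nat \<Rightarrow> nat \<Rightarrow> 'k superfun" and ?x = "xel m :: nat \<Rightarrow> nat \<Rightarrow> 'k superfun"
  have prod: "d (?x i u * ?W u j) = (if u = k then ?x i l * ?W k j else 0)
      - of_bool (k < m) * (?x i u * left_quot m u l * ?W k j)" if u: "u < m" for u
  proof -
    have "d (?x i u * ?W u j) = d (?x i u) * ?W u j + ?x i u * d (?W u j)"
      using i j u
      by (intro deriv_mult_even[OF _ _ homogeneous_xel] inv_entry_mem xel_mem
          homogeneous_inv_entry) auto
    then show ?thesis using i j u by (simp add: deriv_xel deriv_inv_entry mult.assoc)
  qed
  have "d (yel m i j) = (\<Sum>u<m. d (?x i u * ?W u j))"
    unfolding yel_21[OF i(1) j]
    using i j by (intro deriv_sum coord_superalgebra.intros(6) inv_entry_mem xel_mem) auto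
  also have "\<dots> = of_bool (k < m) * (elim_row m i l * ?W k j)"
    by (simp add: prod sum_subtractf elim_row_def sum_distrib_right left_diff_distrib)
  finally show ?thesis .
qed

text \<open>
  Writing the Schur complement as \<open>X\<^sub>2\<^sub>2 - X\<^sub>2\<^sub>1 Y\<^sub>1\<^sub>2\<close> reduces this to \<open>deriv_yel_12\<close>.  The terms
  of \<open>X\<^sub>2\<^sub>2\<close> and of the left factor \<open>X\<^sub>2\<^sub>1\<close> contribute \<open>x\<^sub>i\<^sub>l\<close>, those of the right factor
  \<open>(X\<^sub>2\<^sub>1 Z)\<^sub>i\<^sub>l\<close>, and the two combine to \<open>elim_row\<close> in both summands.
\<close>

lemma deriv_yel_22:
  assumes i: "m \<le> i" "i < m + n" and j: "m \<le> j" "j < m + n"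
  shows "d (yel m i j) = of_bool (j = k) * elim_row m i l
           - sgn_kl * (of_bool (k < m) * (elim_row m i l * yel m k j))"
proof -
  let ?x = "xel m :: nat \<Rightarrow> nat \<Rightarrow> 'k superfun"
  (* The sign is 1 or -1, hence central; the ring is not commutative. *)
  have comm: "a * (sgn_kl * b) = sgn_kl * (a * b)" for a b :: "'k superfun"
    by (simp add: par_def)
  have prod: "d (?x i u * yel m u j) = (if u = k then sgn_kl * (?x i l * yel m k j) else 0)
      + (of_bool (j = k) * (?x i u * left_quot m u l)
      - sgn_kl * (of_bool (k < m) * (?x i u * left_quot m u l * yel m k j)))" if u: "u < m" for u
  proof -
    have "d (?x i u * yel m u j) = sgn_kl * (d (?x i u) * yel m u j) + ?x i u * d (yel m u j)"
      using i j u
      by (intro deriv_mult_odd[OF _ _ homogeneous_xel] yel_12_mem xel_mem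
          homogeneous_yel_12) auto
    then show ?thesis using i j u
      by (simp add: deriv_xel deriv_yel_12 mult.assoc right_diff_distrib comm)
  qed
  have mem: "?x i u * yel m u j \<in> coord_superalgebra m n" if "u < m" for u
    using i j that by (intro coord_superalgebra.intros(6) yel_12_mem xel_mem) auto
  have "d (\<Sum>u<m. ?x i u * yel m u j) = (\<Sum>u<m. d (?x i u * yel m u j))"
    by (rule deriv_sum) (simp add: mem)
  then have "d (yel m i j) = d (?x i j) - (\<Sum>u<m. d (?x i u * yel m u j))"
    unfolding yel_22[OF i(1) j(1)]
    using i j mem by (subst deriv_diff) (auto intro: coord_sum xel_mem)
  also have "\<dots> = of_bool (j = k) * elim_row m i l
           - sgn_kl * (of_bool (k < m) * (elim_row m i l * yel m k j))"
    using i j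
    by (simp add: prod deriv_xel sum.distrib sum_subtractf elim_row_def sum_distrib_right
        sum_distrib_left left_diff_distrib right_diff_distrib)
  finally show ?thesis .
qed

end

theorem proposition4p2:
  fixes m n i j k l :: nat
    and d :: "'k::alg_closed_field superfun \<Rightarrow> 'k superfun"
  assumes "i < m + n" "j < m + n" "k < m + n" "l < m + n"
    and "right_superderivation m n k l d"
  shows
    "((i, j) \<in> I11 m n \<longrightarrow>
        ((k, l) \<in> I11 m n \<longrightarrow> d (yel m i j) = of_bool (j = k) * yel m i l) \<and>
        ((k, l) \<in> I12 m n \<longrightarrow> d (yel m i j) = of_bool (j = k) * (\<Sum>u<m. yel m i u * yel m u l)) \<and>
        ((k, l) \<in> I21 m n \<longrightarrow> d (yel m i j) = 0) \<and>
        ((k, l) \<in> I22 m n \<longrightarrow> d (yel m i j) = 0)) \<and>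
     ((i, j) \<in> I12 m n \<longrightarrow>
        ((k, l) \<in> I11 m n \<longrightarrow> d (yel m i j) = - of_bool (i = l) * yel m k j) \<and>
        ((k, l) \<in> I12 m n \<longrightarrow> d (yel m i j) = yel m i l * yel m k j) \<and>
        ((k, l) \<in> I21 m n \<longrightarrow> d (yel m i j) = of_bool (j = k) * of_bool (i = l)) \<and>
        ((k, l) \<in> I22 m n \<longrightarrow> d (yel m i j) = of_bool (j = k) * yel m i l)) \<and>
     ((i, j) \<in> I21 m n \<longrightarrow>
        ((k, l) \<in> I11 m n \<longrightarrow> d (yel m i j) = 0) \<and>
        ((k, l) \<in> I12 m n \<longrightarrow> d (yel m i j) = yel m i l * adjel m k j * invD m) \<and>
        ((k, l) \<in> I21 m n \<longrightarrow> d (yel m i j) = 0) \<and>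
        ((k, l) \<in> I22 m n \<longrightarrow> d (yel m i j) = 0)) \<and>
     ((i, j) \<in> I22 m n \<longrightarrow>
        ((k, l) \<in> I11 m n \<longrightarrow> d (yel m i j) = 0) \<and>
        ((k, l) \<in> I12 m n \<longrightarrow> d (yel m i j) = yel m i l * yel m k j) \<and>
        ((k, l) \<in> I21 m n \<longrightarrow> d (yel m i j) = 0) \<and>
        ((k, l) \<in> I22 m n \<longrightarrow> d (yel m i j) = of_bool (j = k) * yel m i l))"
proof -
  interpret right_superderiv m n k l d
    by unfold_locales (fact assms)+
  have quot: "inv_entry m k j = adjel m k j * invD m"
    by (simp add: inv_entry_def invD_def inv_evpoly_def gscalar_central)
  show ?thesis
    using assms(1-4)
    by (auto simp: I11_def I12_def I21_def I22_def deriv_yel_11 deriv_yel_12 deriv_yel_21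
        deriv_yel_22 left_quot_even left_quot_odd elim_row_even elim_row_odd quot par_def mult.assoc)
qed

end
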